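(* Let $G$ be a $2$-connected nontrivial uniquely $C_9$-saturated graph, let $C$ be a longest even cycle among the even cycles of $G$ of length at most $12$, and suppose that $C$ has length $12$. Let $R=V(G)\setminus V(C)$. Then at most one vertex of $R$ is attached at distance $1$, and the vertices of $R$ attached at distance $3$ occupy pairwise distinct position pairs, i.e. two distinct vertices of $R$ attached at distance $3$ never have the same pair of neighbours on $C$.
   Context: All graphs are finite and simple. A graph $G$ is uniquely $C_9$-saturated if it contains no cycle of length $9$ and, for every edge $e$ of the complement $\overline{G}$, $G+e$ contains exactly one cycle of length $9$; it is nontrivial if $|V(G)|\ge 9$. Writing $C=[c_0,c_1,\dots,c_{11}]$ in cyclic order, the $C$-distance of $c_i,c_j$ ($0\le i,j\le 11$) is $\min(|i-j|,12-|i-j|)$. A vertex $x\in R$ is attached at distance $d$ if it has two neighbours on $C$ at $C$-distance $d$. (In this setting every vertex of $R$ has exactly two neighbours, both on $C$, at $C$-distance $1$ or $3$.) *)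

theory Defs
  imports Main
begin

text \<open>A graph is given by its vertex set \<open>V\<close> and its set \<open>E\<close> of edges, which are
  two-element subsets of \<open>V\<close>.\<close>

definition all_edges :: "'a set \<Rightarrow> 'a set set" where
  "all_edges V = {e. e \<subseteq> V \<and> card e = 2}"

definition simple_graph :: "'a set \<Rightarrow> 'a set set \<Rightarrow> bool" where
  "simple_graph V E \<longleftrightarrow> finite V \<and> E \<subseteq> all_edges V"

definition connected_graph :: "'a set \<Rightarrow> 'a set set \<Rightarrow> bool" where
  "connected_graph V E \<longleftrightarrow>
     V \<noteq> {} \<and> (\<forall>u\<in>V. \<forall>v\<in>V. (u, v) \<in> {(a, b). {a, b} \<in> E}\<^sup>*)"

definition k_connected :: "nat \<Rightarrow> 'a set \<Rightarrow> 'a set set \<Rightarrow> bool" where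
  "k_connected k V E \<longleftrightarrow> k < card V \<and>
     (\<forall>X\<subseteq>V. card X < k \<longrightarrow> connected_graph (V - X) {e \<in> E. e \<subseteq> V - X})"

definition cycle_edges :: "'a list \<Rightarrow> 'a set set" where
  "cycle_edges c = {{c ! i, c ! (Suc i mod length c)} | i. i < length c}"

text \<open>A list \<open>[c\<^sub>0, \<dots>, c\<^sub>m]\<close> represents a cycle together with a starting vertex and an
  orientation.\<close>

definition is_cycle :: "'a set set \<Rightarrow> 'a list \<Rightarrow> bool" where
  "is_cycle E c \<longleftrightarrow> 3 \<le> length c \<and> distinct c \<and> cycle_edges c \<subseteq> E"

text \<open>For counting, cycles are subgraphs: they are identified with their edge sets, so that
  rotating or reversing the list does not give a new cycle.\<close>

definition cycles_of_length :: "nat \<Rightarrow> 'a set set \<Rightarrow> 'a set set set" where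
  "cycles_of_length k E = {cycle_edges c | c. is_cycle E c \<and> length c = k}"

definition uniquely_cycle_saturated :: "nat \<Rightarrow> 'a set \<Rightarrow> 'a set set \<Rightarrow> bool" where
  "uniquely_cycle_saturated k V E \<longleftrightarrow>
     cycles_of_length k E = {} \<and>
     (\<forall>e \<in> all_edges V - E. \<exists>!F. F \<in> cycles_of_length k (insert e E))"

definition longest_even_cycle_upto :: "nat \<Rightarrow> 'a set set \<Rightarrow> 'a list \<Rightarrow> bool" where
  "longest_even_cycle_upto m E c \<longleftrightarrow>
     is_cycle E c \<and> even (length c) \<and> length c \<le> m \<and>
     (\<forall>c'. is_cycle E c' \<and> even (length c') \<and> length c' \<le> m \<longrightarrow> length c' \<le> length c)"

definition cycle_dist :: "'a list \<Rightarrow> nat \<Rightarrow> nat \<Rightarrow> int" where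
  "cycle_dist c i j = min \<bar>int i - int j\<bar> (int (length c) - \<bar>int i - int j\<bar>)"

definition position_pairs :: "'a set set \<Rightarrow> 'a list \<Rightarrow> int \<Rightarrow> 'a \<Rightarrow> 'a set set" where
  "position_pairs E c d x =
     {{c ! i, c ! j} | i j. i < length c \<and> j < length c \<and> i \<noteq> j \<and> cycle_dist c i j = d \<and>
        {x, c ! i} \<in> E \<and> {x, c ! j} \<in> E}"

definition attached_at_distance :: "'a set set \<Rightarrow> 'a list \<Rightarrow> int \<Rightarrow> 'a \<Rightarrow> bool" where
  "attached_at_distance E c d x \<longleftrightarrow> position_pairs E c d x \<noteq> {}"

end

theory Submission
  imports Defs
begin

text \<open>The proof rests on one consequence of unique saturation: two paths with \<open>k\<close> vertices and the
  same ends have the same vertices (\<open>saturated_paths_same_set\<close>). Indeed, joining the two ends closes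
  both paths to cycles of length \<open>k\<close>; if the ends are already adjacent there is a forbidden cycle,
  and otherwise both cycles are the unique one created by the new edge.

  A vertex \<open>x\<close> off \<open>C\<close> with two neighbours \<open>c\<^sub>m\<close> and \<open>c\<^bsub>m+g\<^esub>\<close> on \<open>C\<close> gives a detour: in an arc of
  \<open>C\<close> that contains both of them, the piece between them may be replaced by \<open>x\<close>. Two vertices with
  detours over the same \<open>g\<close> inside a common arc of the right size therefore coincide
  (\<open>saturated_detour_unique\<close>): were they distinct, each detoured path would avoid the other vertex. When
  \<open>k = 9\<close>, the arc has \<open>8\<close> vertices for \<open>g = 1\<close> and \<open>10\<close> vertices for \<open>g = 3\<close>. On a cycle of length
  \<open>12\<close>, any two edges lie in a common arc with \<open>8\<close> vertices, so \<open>g = 1\<close> occurs at most once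
  altogether; any pair at distance \<open>3\<close> lies in some arc with \<open>10\<close> vertices, so for \<open>g = 3\<close>
  each position is taken at most once.\<close>

section \<open>Closing paths to cycles\<close>

lemma Union_cycle_edges: "\<Union> (cycle_edges p) = set p"
proof
  show "\<Union> (cycle_edges p) \<subseteq> set p"
    unfolding cycle_edges_def by (auto intro!: nth_mem mod_less_divisor)
  show "set p \<subseteq> \<Union> (cycle_edges p)"
    unfolding cycle_edges_def set_conv_nth by blast
qed

lemma is_cycle_close_path:
  assumes "3 \<le> length p" and "distinct p" and "successively (\<lambda>u w. {u, w} \<in> E) p"
  shows "is_cycle (insert {hd p, last p} E) p"
proof -
  have "{p ! i, p ! (Suc i mod length p)} \<in> insert {hd p, last p} E" if i: "i < length p" for i
  proof (cases "Suc i < length p")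
    case True
    with assms(3) show ?thesis by (simp add: successively_conv_nth)
  next
    case False
    with i have "Suc i = length p" by simp
    moreover from i have "p \<noteq> []" by auto
    ultimately have "p ! i = last p" "p ! (Suc i mod length p) = hd p"
      by (simp_all add: last_conv_nth hd_conv_nth flip: \<open>Suc i = length p\<close>)
    then show ?thesis by (simp add: insert_commute)
  qed
  with assms show ?thesis unfolding is_cycle_def cycle_edges_def by auto
qed

lemma saturated_paths_same_set:
  assumes sat: "uniquely_cycle_saturated k V E" and k: "3 \<le> k"
    and p: "distinct p" "successively (\<lambda>u w. {u, w} \<in> E) p" "length p = k"
    and q: "distinct q" "successively (\<lambda>u w. {u, w} \<in> E) q" "length q = k"
    and ends: "hd p = hd q" "last p = last q" "hd p \<in> V" "last p \<in> V"
  shows "set p = set q"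
proof -
  let ?e = "{hd p, last p}"
  have cycles: "cycle_edges p \<in> cycles_of_length k (insert ?e E)"
    "cycle_edges q \<in> cycles_of_length k (insert ?e E)"
    using is_cycle_close_path[OF _ p(1,2)] is_cycle_close_path[OF _ q(1,2)] p(3) q(3) k ends(1,2)
    unfolding cycles_of_length_def by auto
  with sat have "?e \<notin> E"
    unfolding uniquely_cycle_saturated_def by (auto simp: insert_absorb)
  moreover have "hd p \<noteq> last p"
    using p(1,3) k by (cases p) auto
  then have "?e \<in> all_edges V"
    using ends(3,4) by (simp add: all_edges_def)
  ultimately have "cycle_edges p = cycle_edges q"
    using sat cycles unfolding uniquely_cycle_saturated_def by blast
  then show ?thesis by (metis Union_cycle_edges)
qed

section \<open>Arcs and detours\<close>

text \<open>Unrolling the cycle to a periodic sequence makes every arc an interval of indices, also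
  when it passes the starting vertex of the list.\<close>

definition cyc_nth :: "'a list \<Rightarrow> nat \<Rightarrow> 'a" where
  "cyc_nth c i = c ! (i mod length c)"

lemma cyc_nth_add_length [simp]: "cyc_nth c (i + length c) = cyc_nth c i"
  by (simp add: cyc_nth_def)

lemma cyc_nth_in_set: "c \<noteq> [] \<Longrightarrow> cyc_nth c i \<in> set c"
  by (simp add: cyc_nth_def)

lemma cyc_nth_edge:
  assumes "is_cycle E c"
  shows "{cyc_nth c i, cyc_nth c (Suc i)} \<in> E"
proof -
  have "i mod length c < length c" using assms by (intro mod_less_divisor) (auto simp: is_cycle_def)
  then have "{c ! (i mod length c), c ! (Suc (i mod length c) mod length c)} \<in> E"
    using assms unfolding is_cycle_def cycle_edges_def by blast
  then show ?thesis by (simp add: cyc_nth_def mod_Suc_eq)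
qed

lemma inj_on_cyc_nth:
  assumes "distinct c" and "t \<le> s + length c"
  shows "inj_on (cyc_nth c) {s..<t}"
proof (rule linorder_inj_onI')
  fix i j assume ij: "i \<in> {s..<t}" "j \<in> {s..<t}" "i < j"
  with assms(2) have small: "0 < j - i" "j - i < length c" by auto
  show "cyc_nth c i \<noteq> cyc_nth c j"
  proof
    assume "cyc_nth c i = cyc_nth c j"
    moreover have "0 < length c" using small by linarith
    then have "i mod length c < length c" "j mod length c < length c" by simp_all
    ultimately have "j mod length c = i mod length c"
      using assms(1) by (simp add: cyc_nth_def nth_eq_iff_index_eq)
    then have "length c dvd j - i" using ij(3) by (simp add: mod_eq_dvd_iff_nat)
    with small show False by (simp add: nat_dvd_not_less)
  qed
qed

definition detour :: "'a list \<Rightarrow> nat \<Rightarrow> nat \<Rightarrow> nat \<Rightarrow> nat \<Rightarrow> 'a \<Rightarrow> 'a list" where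
  "detour c s m n t x = map (cyc_nth c) [s..<Suc m] @ x # map (cyc_nth c) [n..<t]"

lemma
  assumes "s \<le> m" "n < t"
  shows hd_detour: "hd (detour c s m n t x) = cyc_nth c s"
    and last_detour: "last (detour c s m n t x) = cyc_nth c (t - 1)"
    and length_detour: "length (detour c s m n t x) = (m - s) + 2 + (t - n)"
  using assms by (auto simp: detour_def hd_append hd_map last_map simp del: upt_Suc)

lemma set_detour: "c \<noteq> [] \<Longrightarrow> x \<in> set (detour c s m n t x) \<and> set (detour c s m n t x) \<subseteq> insert x (set c)"
  by (auto simp: detour_def cyc_nth_in_set)

lemma distinct_detour:
  assumes "distinct c" "c \<noteq> []" "x \<notin> set c" "s \<le> m" "m < n" "n < t" "t \<le> s + length c"
  shows "distinct (detour c s m n t x)"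
proof -
  have inj: "inj_on (cyc_nth c) {s..<t}" using assms by (intro inj_on_cyc_nth)
  have "distinct (map (cyc_nth c) ([s..<Suc m] @ [n..<t]))"
    unfolding distinct_map using assms by (auto intro!: inj_on_subset[OF inj] simp del: upt_Suc)
  moreover have "x \<notin> set (map (cyc_nth c) ([s..<Suc m] @ [n..<t]))"
    using assms(3) cyc_nth_in_set[OF assms(2)] by auto
  ultimately show ?thesis by (simp add: detour_def del: upt_Suc)
qed

lemma successively_detour:
  assumes c: "is_cycle E c" and "s \<le> m" "n < t"
    and x: "{x, cyc_nth c m} \<in> E" "{x, cyc_nth c n} \<in> E"
  shows "successively (\<lambda>u w. {u, w} \<in> E) (detour c s m n t x)"
proof -
  have arc: "successively (\<lambda>u w. {u, w} \<in> E) (map (cyc_nth c) [a..<b])" for a b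
    using cyc_nth_edge[OF c] by (simp add: successively_conv_nth)
  have "{cyc_nth c m, x} \<in> E" using x(1) by (simp add: insert_commute)
  then show ?thesis
    using arc[of s "Suc m"] arc[of n t] assms
    by (simp add: detour_def successively_append_iff successively_Cons hd_map last_map del: upt_Suc)
qed

text \<open>The arc runs over the indices from \<open>s\<close> to \<open>t - 1\<close>. A detour skips \<open>g - 1\<close> of its vertices and
  adds one, hence has \<open>t - s + 2 - g\<close> vertices; the arc is chosen so that
  this number is \<open>k\<close>.\<close>

lemma saturated_detour_unique:
  assumes sat: "uniquely_cycle_saturated k V E" and k: "3 \<le> k"
    and c: "is_cycle E c" "set c \<subseteq> V" and arc: "t \<le> s + length c" "t + 2 = s + k + g" and g: "0 < g"
    and x: "x \<notin> set c" "s \<le> m" "m + g < t" "{x, cyc_nth c m} \<in> E" "{x, cyc_nth c (m + g)} \<in> E"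
    and y: "y \<notin> set c" "s \<le> n" "n + g < t" "{y, cyc_nth c n} \<in> E" "{y, cyc_nth c (n + g)} \<in> E"
  shows "x = y"
proof -
  let ?p = "detour c s m (m + g) t x" and ?q = "detour c s n (n + g) t y"
  have c': "distinct c" "c \<noteq> []" using c(1) by (auto simp: is_cycle_def)
  note ends = hd_detour last_detour
  have "set ?p = set ?q"
  proof (rule saturated_paths_same_set[OF sat k])
    show "distinct ?p" "distinct ?q"
      using c' arc g x y by (auto intro!: distinct_detour)
    show "successively (\<lambda>u w. {u, w} \<in> E) ?p" "successively (\<lambda>u w. {u, w} \<in> E) ?q"
      using c(1) x y by (auto intro!: successively_detour)
    show "length ?p = k" "length ?q = k"
      using arc x y by (simp_all add: length_detour)
    show "hd ?p = hd ?q" "last ?p = last ?q" using x y by (simp_all add: ends)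
    show "hd ?p \<in> V" "last ?p \<in> V"
      using x c(2) cyc_nth_in_set[OF c'(2)] by (auto simp: ends)
  qed
  then show ?thesis using set_detour[OF c'(2)] x(1) by blast
qed

section \<open>Attached vertices\<close>

lemma cycle_vertices_in_graph:
  assumes "simple_graph V E" and "is_cycle E c"
  shows "set c \<subseteq> V"
  using assms Union_cycle_edges[of c] unfolding simple_graph_def all_edges_def is_cycle_def by blast

lemma position_pair_edges: "P \<in> position_pairs E c d x \<Longrightarrow> v \<in> P \<Longrightarrow> {x, v} \<in> E"
  by (auto simp: position_pairs_def)

lemma position_pair_cyc_nth:
  assumes "P \<in> position_pairs E c (int d) x"
  obtains m where "m < length c" "P = {cyc_nth c m, cyc_nth c (m + d)}"
proof -
  obtain i j where P: "P = {c ! i, c ! j}" and ij: "i < j" "j < length c" "cycle_dist c i j = int d"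
  proof -
    obtain i j where *: "P = {c ! i, c ! j}" "i < length c" "j < length c" "i \<noteq> j"
      "cycle_dist c i j = int d"
      using assms unfolding position_pairs_def by blast
    show thesis
    proof (cases "i < j")
      case True
      with * that show ?thesis by blast
    next
      case False
      have "cycle_dist c j i = cycle_dist c i j"
        by (simp add: cycle_dist_def abs_minus_commute)
      with * False that[of j i] show ?thesis by (simp add: insert_commute)
    qed
  qed
  have "j = i + d \<or> i + length c = j + d"
    using ij by (auto simp: cycle_dist_def min_def split: if_splits)
  then show thesis
  proof
    assume "j = i + d"
    with ij P show ?thesis by (intro that[of i]) (simp_all add: cyc_nth_def)
  next
    assume "i + length c = j + d"
    then have "cyc_nth c (j + d) = c ! i" using ij by (simp add: cyc_nth_def flip: \<open>i + length c = j + d\<close>)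
    with ij P show ?thesis by (intro that[of j]) (auto simp: cyc_nth_def)
  qed
qed

theorem lemma3p3:
  fixes V :: "'a set" and E :: "'a set set" and c :: "'a list"
  assumes "simple_graph V E"
    and "k_connected 2 V E"
    and "uniquely_cycle_saturated 9 V E"
    and "9 \<le> card V"
    and "longest_even_cycle_upto 12 E c"
    and "length c = 12"
  defines "R \<equiv> V - set c"
  shows "(\<exists>\<^sub>\<le>\<^sub>1x. x \<in> R \<and> attached_at_distance E c 1 x) \<and>
    (\<forall>x\<in>R. \<forall>y\<in>R. x \<noteq> y \<and> attached_at_distance E c 3 x \<and> attached_at_distance E c 3 y \<longrightarrow>
       position_pairs E c 3 x \<inter> position_pairs E c 3 y = {})"
proof
  have c: "is_cycle E c" using assms(5) by (simp add: longest_even_cycle_upto_def)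
  have cV: "set c \<subseteq> V" using assms(1) c by (rule cycle_vertices_in_graph)
  note unique = saturated_detour_unique[OF assms(3) _ c cV]

  have dist1: "\<exists>m<12. {x, cyc_nth c m} \<in> E \<and> {x, cyc_nth c (m + 1)} \<in> E"
    if x: "attached_at_distance E c 1 x" for x
  proof -
    obtain P where P: "P \<in> position_pairs E c (int 1) x"
      using x by (auto simp: attached_at_distance_def)
    then obtain m where "m < length c" "P = {cyc_nth c m, cyc_nth c (m + 1)}"
      by (rule position_pair_cyc_nth)
    then show ?thesis using position_pair_edges[OF P] assms(6) by auto
  qed

  show "\<exists>\<^sub>\<le>\<^sub>1x. x \<in> R \<and> attached_at_distance E c 1 x"
  proof (rule Uniq_I)
    fix x y
    assume "x \<in> R \<and> attached_at_distance E c 1 x" "y \<in> R \<and> attached_at_distance E c 1 y"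
    then obtain m n where xy: "x \<notin> set c" "y \<notin> set c" and mn: "m < 12" "n < 12"
      and x: "{x, cyc_nth c m} \<in> E" "{x, cyc_nth c (m + 1)} \<in> E"
      and y: "{y, cyc_nth c n} \<in> E" "{y, cyc_nth c (n + 1)} \<in> E"
      using dist1 unfolding R_def by blast
    have near: "x = y"
      if "m \<le> n" "n \<le> m + 6" "x \<notin> set c" "y \<notin> set c"
        "{x, cyc_nth c m} \<in> E" "{x, cyc_nth c (m + 1)} \<in> E"
        "{y, cyc_nth c n} \<in> E" "{y, cyc_nth c (n + 1)} \<in> E" for x y m n
      using that assms(6) by (intro unique[of "m + 8" m 1 x m y n]) auto
    have shift: "cyc_nth c (i + 12) = cyc_nth c i" "cyc_nth c (i + 12 + 1) = cyc_nth c (i + 1)" for i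
      using cyc_nth_add_length[of c i] cyc_nth_add_length[of c "i + 1"] assms(6)
      by (simp_all add: algebra_simps)
    \<comment> \<open>One of the two edges of the cycle is reached from the other, going forward, within \<open>6\<close>
      steps; the last two cases pass the starting vertex.\<close>
    consider "m \<le> n" "n \<le> m + 6" | "n \<le> m" "m \<le> n + 6" | "n \<le> m + 12" "m + 12 \<le> n + 6"
      | "m \<le> n + 12" "n + 12 \<le> m + 6"
      using mn by linarith
    then show "x = y"
    proof cases
      case 1
      with xy x y show ?thesis by (intro near)
    next
      case 2
      with xy x y show ?thesis by (intro near[symmetric])
    next
      case 3
      with xy x y show ?thesis by (intro near[symmetric, of n "m + 12"]) (simp_all only: shift not_False_eq_True)
    next
      case 4
      with xy x y show ?thesis by (intro near[of m "n + 12"]) (simp_all only: shift not_False_eq_True)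
    qed
  qed

  show "\<forall>x\<in>R. \<forall>y\<in>R. x \<noteq> y \<and> attached_at_distance E c 3 x \<and> attached_at_distance E c 3 y \<longrightarrow>
       position_pairs E c 3 x \<inter> position_pairs E c 3 y = {}"
  proof (intro ballI impI equals0I)
    fix x y P
    assume xy: "x \<in> R" "y \<in> R" "x \<noteq> y \<and> attached_at_distance E c 3 x \<and> attached_at_distance E c 3 y"
      and P: "P \<in> position_pairs E c 3 x \<inter> position_pairs E c 3 y"
    then have "P \<in> position_pairs E c (int 3) x" by simp
    then obtain m where m: "P = {cyc_nth c m, cyc_nth c (m + 3)}"
      by (rule position_pair_cyc_nth)
    have "{z, cyc_nth c m} \<in> E \<and> {z, cyc_nth c (m + 3)} \<in> E" if "z = x \<or> z = y" for z
      using that P position_pair_edges[of P E c 3] unfolding m by auto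
    with xy assms(6) have "x = y"
      by (intro unique[of "m + 10" m 3 x m y m]) (auto simp: R_def)
    with xy show False by simp
  qed
qed

end
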